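(* Let $f\colon X\to Y$ be a continuous map from a compact graph $X$ to a metric compactum $Y$, and let $\varepsilon>0$. The following conditions are equivalent. (i) $f$ is $\varepsilon$-crooked. (ii) $f\circ e$ is $\varepsilon$-crooked for every continuous map $e\colon[0,1]\to X$. (iii) For every ordered arc $[x,y]\subseteq X$ there are points $x\le y'\le x'\le y$ of $[x,y]$ (with respect to the order of the arc) such that $d(f(x),f(x'))<\varepsilon$ and $d(f(y),f(y'))<\varepsilon$.
   Context: A metric compactum is a compact metric space. A compact graph is a topological realization of a finite simplicial complex of dimension at most $1$ (equivalently, a finite union of arcs that intersect at most at their end-points). An ordered arc $[x,y]$ in a space $X$, for $x\ne y$, is the image of an embedding $e\colon[0,1]\to X$ with $e(0)=x$ and $e(1)=y$, together with the linear order induced from $[0,1]$; also $[x,x]$ denotes the degenerate ordered arc $\{x\}$. Crookedness. Let $A,B,U_A,U_B$ be subsets of a Hausdorff compactum $X$. The space $X$ is crooked at the quadruple $\langle A,B,U_A,U_B\rangle$ if there is a cover $X=F_A\cup H\cup F_B$ by closed sets such that $A\subseteq F_A$, $B\subseteq F_B$, $F_A\cap H\subseteq U_B$, $F_B\cap H\subseteq U_A$, and $F_A\cap F_B\subseteq U_A\cap U_B$. A continuous map $f\colon X\to Y$ between Hausdorff compacta is crooked at a quadruple $\langle A,B,U_A,U_B\rangle$ of subsets of $Y$ if $X$ is crooked at $\langle f^{-1}[A],f^{-1}[B],f^{-1}[U_A],f^{-1}[U_B]\rangle$. If $Y$ is metric and $\varepsilon>0$, then $f$ is $\varepsilon$-crooked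 at $\langle A,B\rangle$ if it is crooked at $\langle A,B,N_\varepsilon(A),N_\varepsilon(B)\rangle$, where $N_\varepsilon(A)=\{y\in Y: d(y,A)<\varepsilon\}$ (with $N_\varepsilon(\emptyset)=\emptyset$). The map $f$ is $\varepsilon$-crooked if it is $\varepsilon$-crooked at every pair $\langle A,B\rangle$ of closed subsets of $Y$. *)

theory Defs
  imports "HOL-Analysis.Analysis"
begin

text \<open>
  Spaces are abstract topologies; a metric compactum is a compact subset of a metric space,
  taken with the induced metric.

  Finite simplicial complexes of dimension at most 1 are taken as geometric complexes in
  three-dimensional Euclidean space. This loses no generality: placing the vertices in general
  position realizes every finite complex of dimension at most 1 there.  Isolated points and
  the empty graph are allowed.
\<close>

definition compact_graph :: "'a topology \<Rightarrow> bool" where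
  "compact_graph X \<longleftrightarrow>
    (\<exists>\<C> :: (real^3) set set. simplicial_complex \<C> \<and> (\<forall>S\<in>\<C>. aff_dim S \<le> 1) \<and>
       X homeomorphic_space top_of_set (\<Union>\<C>))"

text \<open>
  An ordered arc \<open>[x,y]\<close> is given by its underlying set \<open>J\<close> and its order relation \<open>r\<close>;
  \<open>(p, q) \<in> r\<close> means \<open>p \<le> q\<close> along the arc.
\<close>

definition ordered_arc :: "'a topology \<Rightarrow> 'a \<Rightarrow> 'a \<Rightarrow> 'a set \<Rightarrow> 'a rel \<Rightarrow> bool" where
  "ordered_arc X x y J r \<longleftrightarrow>
    x \<in> topspace X \<and> x = y \<and> J = {x} \<and> r = {(x, x)} \<or>
    x \<noteq> y \<and>
      (\<exists>e. embedding_map (top_of_set {0..1::real}) X e \<and> e 0 = x \<and> e 1 = y \<and>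
           J = e ` {0..1} \<and> r = {(e s, e t) | s t. 0 \<le> s \<and> s \<le> t \<and> t \<le> 1})"

definition crooked_space :: "'a topology \<Rightarrow> 'a set \<Rightarrow> 'a set \<Rightarrow> 'a set \<Rightarrow> 'a set \<Rightarrow> bool" where
  "crooked_space X A B U\<^sub>A U\<^sub>B \<longleftrightarrow>
    (\<exists>F\<^sub>A H F\<^sub>B. closedin X F\<^sub>A \<and> closedin X H \<and> closedin X F\<^sub>B \<and>
       topspace X = F\<^sub>A \<union> H \<union> F\<^sub>B \<and> A \<subseteq> F\<^sub>A \<and> B \<subseteq> F\<^sub>B \<and>
       F\<^sub>A \<inter> H \<subseteq> U\<^sub>B \<and> F\<^sub>B \<inter> H \<subseteq> U\<^sub>A \<and> F\<^sub>A \<inter> F\<^sub>B \<subseteq> U\<^sub>A \<inter> U\<^sub>B)"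

definition crooked_map ::
  "'a topology \<Rightarrow> ('a \<Rightarrow> 'b) \<Rightarrow> 'b set \<Rightarrow> 'b set \<Rightarrow> 'b set \<Rightarrow> 'b set \<Rightarrow> bool" where
  "crooked_map X f A B U\<^sub>A U\<^sub>B \<longleftrightarrow>
    crooked_space X (topspace X \<inter> f -` A) (topspace X \<inter> f -` B)
      (topspace X \<inter> f -` U\<^sub>A) (topspace X \<inter> f -` U\<^sub>B)"

text \<open>The case \<open>A = {}\<close> is excluded explicitly because the library sets \<open>infdist y {} = 0\<close>.\<close>

definition nbhd :: "'b::metric_space set \<Rightarrow> real \<Rightarrow> 'b set \<Rightarrow> 'b set" where
  "nbhd Y \<epsilon> A = {y \<in> Y. A \<noteq> {} \<and> infdist y A < \<epsilon>}"

definition eps_crooked_at ::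
  "'a topology \<Rightarrow> 'b::metric_space set \<Rightarrow> real \<Rightarrow> ('a \<Rightarrow> 'b) \<Rightarrow> 'b set \<Rightarrow> 'b set \<Rightarrow> bool" where
  "eps_crooked_at X Y \<epsilon> f A B \<longleftrightarrow> crooked_map X f A B (nbhd Y \<epsilon> A) (nbhd Y \<epsilon> B)"

definition eps_crooked ::
  "'a topology \<Rightarrow> 'b::metric_space set \<Rightarrow> real \<Rightarrow> ('a \<Rightarrow> 'b) \<Rightarrow> bool" where
  "eps_crooked X Y \<epsilon> f \<longleftrightarrow>
    (\<forall>A B. closedin (top_of_set Y) A \<and> closedin (top_of_set Y) B \<longrightarrow> eps_crooked_at X Y \<epsilon> f A B)"

end

theory Submission
  imports Defs
begin

text \<open>
  Pulling back the cover gives (i) to (ii). For (ii) to (iii), cover \<open>[0,1]\<close> by \<open>F\<^sub>A\<close>, \<open>H\<close>, \<open>F\<^sub>B\<close>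
  for \<open>A = {f x}\<close>, \<open>B = {f y}\<close>: the first point of \<open>F\<^sub>B\<close> yields \<open>x'\<close>, and before it the connected
  initial segment must pass through \<open>F\<^sub>A \<inter> H\<close>, which yields \<open>y'\<close>.

  For (iii) to (i), a cover amounts to disjoint sets \<open>C\<close> and \<open>D\<close>, clopen in the complements of \<open>U\<^sub>B\<close>
  and \<open>U\<^sub>A\<close>, that contain \<open>A - U\<^sub>B\<close> and \<open>B - U\<^sub>A\<close>. In a compact Hausdorff space they exist
  unless a connected set that avoids \<open>U\<^sub>B\<close> and meets \<open>A\<close> intersects a connected set that avoids
  \<open>U\<^sub>A\<close> and meets \<open>B\<close>. Connected closed subsets of a graph are arcwise connected, so in that case
  there is an arc from \<open>A\<close> to \<open>B\<close> whose first part avoids \<open>U\<^sub>B\<close> and whose second part avoids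
  \<open>U\<^sub>A\<close>, contrary to (iii).
\<close>

section \<open>Crookedness under composition\<close>

lemma crooked_space_pullback:
  assumes "crooked_space X A B U V" and g: "continuous_map W X g"
  shows "crooked_space W (topspace W \<inter> g -` A) (topspace W \<inter> g -` B)
           (topspace W \<inter> g -` U) (topspace W \<inter> g -` V)"
proof -
  obtain P H Q where "closedin X P" "closedin X H" "closedin X Q"
    and cov: "topspace X = P \<union> H \<union> Q" and sub: "A \<subseteq> P" "B \<subseteq> Q" "P \<inter> H \<subseteq> V" "Q \<inter> H \<subseteq> U" "P \<inter> Q \<subseteq> U \<inter> V"
    using assms(1) unfolding crooked_space_def by metis
  then have "closedin W {w \<in> topspace W. g w \<in> P}" "closedin W {w \<in> topspace W. g w \<in> H}"
    "closedin W {w \<in> topspace W. g w \<in> Q}"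
    using closedin_continuous_map_preimage[OF g] by blast+
  moreover have "g w \<in> P \<union> H \<union> Q" if "w \<in> topspace W" for w
    using continuous_map_image_subset_topspace[OF g] that cov by blast
  ultimately show ?thesis
    unfolding crooked_space_def using sub
    by (rule_tac exI[of _ "{w \<in> topspace W. g w \<in> P}"],
        rule_tac exI[of _ "{w \<in> topspace W. g w \<in> H}"],
        rule_tac exI[of _ "{w \<in> topspace W. g w \<in> Q}"]) blast
qed

lemma eps_crooked_compose:
  assumes "eps_crooked X Y \<epsilon> f" and g: "continuous_map W X g"
  shows "eps_crooked W Y \<epsilon> (f \<circ> g)"
proof -
  have "topspace W \<inter> g -` (topspace X \<inter> f -` S) = topspace W \<inter> (f \<circ> g) -` S" for S
    using continuous_map_image_subset_topspace[OF g] by auto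
  then show ?thesis
    using assms(1) crooked_space_pullback[OF _ g]
    unfolding eps_crooked_def eps_crooked_at_def crooked_map_def by metis
qed

lemma eps_crooked_cong:
  assumes "\<And>x. x \<in> topspace X \<Longrightarrow> f x = g x"
  shows "eps_crooked X Y \<epsilon> f \<longleftrightarrow> eps_crooked X Y \<epsilon> g"
proof -
  have "topspace X \<inter> f -` S = topspace X \<inter> g -` S" for S
    using assms by auto
  then show ?thesis
    unfolding eps_crooked_def eps_crooked_at_def crooked_map_def by simp
qed

section \<open>Metric neighbourhoods\<close>

lemma mem_nbhd_singleton: "y \<in> nbhd Y \<epsilon> {a} \<longleftrightarrow> y \<in> Y \<and> dist a y < \<epsilon>"
  by (simp add: nbhd_def dist_commute)

lemma nbhd_dist:
  assumes "y \<in> Y" "a \<in> A" "dist a y < \<epsilon>"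
  shows "y \<in> nbhd Y \<epsilon> A"
  using assms infdist_le[of a A y] by (auto simp: nbhd_def dist_commute)

lemma subset_nbhd: "A \<subseteq> Y \<Longrightarrow> 0 < \<epsilon> \<Longrightarrow> A \<subseteq> nbhd Y \<epsilon> A"
  by (auto intro: nbhd_dist)

lemma openin_nbhd: "openin (top_of_set Y) (nbhd Y \<epsilon> A)"
\<comment> \<open>The sublevel description of \<open>nbhd\<close> fails for the empty set: its
  neighbourhood is empty, while \<open>infdist\<close> to it is 0.\<close>
proof (cases "A = {}")
  case False
  have "open {y. infdist y A < \<epsilon>}"
    by (intro open_Collect_less continuous_on_infdist continuous_on_id continuous_on_const)
  moreover have "nbhd Y \<epsilon> A = Y \<inter> {y. infdist y A < \<epsilon>}"
    using False by (auto simp: nbhd_def)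
  ultimately show ?thesis
    by (auto simp: openin_open)
qed (auto simp: nbhd_def)

section \<open>Crooked maps on the unit interval\<close>

lemma eps_crooked_interval:
  fixes f :: "real \<Rightarrow> 'b::metric_space"
  assumes cr: "eps_crooked (top_of_set {0..1}) Y \<epsilon> f" and fY: "f 0 \<in> Y" "f 1 \<in> Y"
  obtains s t where "0 \<le> s" "s \<le> t" "t \<le> 1" "dist (f 0) (f t) < \<epsilon>" "dist (f 1) (f s) < \<epsilon>"
proof -
  have "closedin (top_of_set Y) {f 0}" "closedin (top_of_set Y) {f 1}"
    using fY by (auto simp: closed_subset)
  then have "crooked_map (top_of_set {0..1}) f {f 0} {f 1} (nbhd Y \<epsilon> {f 0}) (nbhd Y \<epsilon> {f 1})"
    using cr by (simp add: eps_crooked_def eps_crooked_at_def)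
  then obtain P H Q where cl: "closedin (top_of_set {0..1}) P" "closedin (top_of_set {0..1}) H"
      "closedin (top_of_set {0..1}) Q"
    and cov: "{0..1} = P \<union> H \<union> Q"
    and end0: "{0..1} \<inter> f -` {f 0} \<subseteq> P" and end1: "{0..1} \<inter> f -` {f 1} \<subseteq> Q"
    and PH: "P \<inter> H \<subseteq> {0..1} \<inter> f -` nbhd Y \<epsilon> {f 1}"
    and QH: "Q \<inter> H \<subseteq> {0..1} \<inter> f -` nbhd Y \<epsilon> {f 0}"
    and PQ: "P \<inter> Q \<subseteq> ({0..1} \<inter> f -` nbhd Y \<epsilon> {f 0}) \<inter> ({0..1} \<inter> f -` nbhd Y \<epsilon> {f 1})"
    unfolding crooked_map_def crooked_space_def by auto
  have comp: "compact P" "compact H" "compact Q"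
    using cl by (simp_all add: closedin_compact_eq)
  have "0 \<in> P" "1 \<in> Q"
    using end0 end1 by auto
  then obtain t where t: "t \<in> Q" and tmin: "\<And>u. u \<in> Q \<Longrightarrow> t \<le> u"
    using compact_attains_inf[OF comp(3)] by auto
  have t01: "0 \<le> t" "t \<le> 1"
    using t cov by auto
  show thesis
  \<comment> \<open>Here \<open>t\<close> is the first time in \<open>Q\<close>. If it also lies in
    \<open>P\<close>, then \<open>f t\<close> is close to both end values and \<open>s = t\<close>
    serves.\<close>
  proof (cases "t \<in> P")
    case True
    then show thesis
      using that[of t t] subsetD[OF PQ, of t] t t01 by (auto simp: mem_nbhd_singleton)
  next
    case False
    have PHcov: "{0..<t} \<subseteq> P \<union> H"
      using tmin cov t01 by force
    have "t \<noteq> 0"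
      using False \<open>0 \<in> P\<close> by auto
    have "closed (P \<union> H)"
      using comp by (simp add: compact_imp_closed closed_Un)
    \<comment> \<open>No time before \<open>t\<close> lies in \<open>Q\<close>, and closedness of
      \<open>P\<close> and \<open>H\<close> adds the end point \<open>t\<close>. As \<open>t\<close>
      is not in \<open>P\<close>, it must lie in \<open>H\<close>.\<close>
    then have PHcov': "{0..t} \<subseteq> P \<union> H"
      using closure_minimal[OF PHcov] \<open>t \<noteq> 0\<close> t01 by simp
    then have "t \<in> H"
      using False t01 by auto
    \<comment> \<open>Otherwise \<open>P\<close>, which contains 0, and \<open>H\<close>, which
      contains \<open>t\<close>, would disconnect the segment.\<close>
    have "{0..t} \<inter> P \<inter> H \<noteq> {}"
    proof
      assume "{0..t} \<inter> P \<inter> H = {}"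
      then have "P \<inter> H \<inter> {0..t} = {}"
        by auto
      moreover have "connected {0..t}"
        by simp
      ultimately have "P \<inter> {0..t} = {} \<or> H \<inter> {0..t} = {}"
        using PHcov' comp by (intro connected_closedD) (auto simp: compact_imp_closed)
      then show False
        using \<open>0 \<in> P\<close> \<open>t \<in> H\<close> t01 by auto
    qed
    then obtain s where "s \<in> {0..t}" "s \<in> P" "s \<in> H"
      by blast
    then show thesis
      using that[of s t] subsetD[OF PH, of s] subsetD[OF QH, of t] \<open>t \<in> H\<close> t t01
      by (auto simp: mem_nbhd_singleton)
  qed
qed

section \<open>Separation by clopen sets in compact Hausdorff spaces\<close>

text \<open>This is the cut-wire fence theorem in the subspace \<open>K\<close>. As \<open>K\<close>
  is closed, clopenness in \<open>K\<close> amounts to closedness of \<open>C\<close> and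
  \<open>K - C\<close> in \<open>X\<close>.\<close>

lemma clopen_separation:
  assumes X: "compact_space X" "Hausdorff_space X"
    and K: "closedin X K" and S: "closedin X S" "S \<subseteq> K" and T: "closedin X T"
    and dis: "\<And>C. connectedin X C \<Longrightarrow> C \<subseteq> K \<Longrightarrow> C \<inter> S = {} \<or> C \<inter> T = {}"
  obtains C where "closedin X C" "closedin X (K - C)" "S \<subseteq> C" "C \<subseteq> K" "C \<inter> T = {}"
proof -
  have KX: "K \<subseteq> topspace X"
    using K closedin_subset by blast
  have sub: "closedin (subtopology X K) D \<longleftrightarrow> closedin X D \<and> D \<subseteq> K" for D
    using K by (simp add: closedin_closed_subtopology)
  have "separated_between (subtopology X K) S (T \<inter> K)"
  proof (rule cut_wire_fence_theorem)
    show "compact_space (subtopology X K)"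
      using X K by (simp add: closedin_compact_space compact_space_subtopology)
    show "Hausdorff_space (subtopology X K)"
      using X by (simp add: Hausdorff_space_subtopology)
    show "disjnt C S \<or> disjnt C (T \<inter> K)" if "connectedin (subtopology X K) C" for C
      using dis[of C] that by (auto simp: connectedin_subtopology disjnt_def)
  qed (use S T K in \<open>auto simp: sub\<close>)
  then obtain C where "closedin (subtopology X K) C" "openin (subtopology X K) C" "S \<subseteq> C"
    "T \<inter> K \<subseteq> topspace (subtopology X K) - C"
    unfolding separated_between by blast
  then show thesis
    using that[of C] KX
    by (auto simp: sub openin_closedin_eq Int_absorb1)
qed

text \<open>Let \<open>Q\<close> be the intersection of all clopen subsets of \<open>L\<close> that
  contain \<open>T\<close>. Its points are joined to \<open>T\<close> by connected subsets of
  \<open>L\<close>, so \<open>dis\<close> allows a choice of \<open>C\<close> disjoint from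
  \<open>Q\<close>. Connected subsets of \<open>L\<close> that meet \<open>T\<close> stay in
  \<open>Q\<close>, so \<open>D\<close> can then be chosen disjoint from \<open>C\<close>.\<close>

lemma disjoint_clopen_pair:
  assumes X: "compact_space X" "Hausdorff_space X"
    and K: "closedin X K" "closedin X L"
    and S: "closedin X S" "S \<subseteq> K" and T: "closedin X T" "T \<subseteq> L"
    and dis: "\<And>C D. \<lbrakk>connectedin X C; C \<subseteq> K; C \<inter> S \<noteq> {}; connectedin X D; D \<subseteq> L; D \<inter> T \<noteq> {}\<rbrakk>
                \<Longrightarrow> C \<inter> D = {}"
  obtains C D where "closedin X C" "closedin X (K - C)" "S \<subseteq> C" "C \<subseteq> K"
    "closedin X D" "closedin X (L - D)" "T \<subseteq> D" "D \<subseteq> L" "C \<inter> D = {}"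
proof -
  define \<D> where "\<D> = {D. closedin X D \<and> closedin X (L - D) \<and> T \<subseteq> D \<and> D \<subseteq> L}"
  define Q where "Q = \<Inter>\<D>"
  have "L \<in> \<D>"
    using K T by (simp add: \<D>_def)
  then have Q: "closedin X Q" "Q \<subseteq> L"
    unfolding Q_def by (auto intro!: closedin_Inter simp: \<D>_def)
  \<comment> \<open>Otherwise \<open>clopen_separation\<close> gives a member of \<open>\<D>\<close>
    that omits \<open>z\<close>.\<close>
  have joined: "\<exists>D. connectedin X D \<and> D \<subseteq> L \<and> z \<in> D \<and> D \<inter> T \<noteq> {}" if "z \<in> Q" for z
  proof (rule ccontr)
    assume no: "\<not> ?thesis"
    have "z \<in> topspace X"
      using that Q closedin_subset by blast
    then have z: "closedin X {z}"
      by (simp add: X closedin_Hausdorff_singleton)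
    have "C \<inter> T = {} \<or> C \<inter> {z} = {}" if "connectedin X C" "C \<subseteq> L" for C
      using no that by blast
    then obtain D where "closedin X D" "closedin X (L - D)" "T \<subseteq> D" "D \<subseteq> L" "D \<inter> {z} = {}"
      using clopen_separation[OF X K(2) T z] by (metis (no_types, lifting))
    then show False
      using that by (auto simp: Q_def \<D>_def)
  qed
  have "C \<inter> S = {} \<or> C \<inter> Q = {}" if "connectedin X C" "C \<subseteq> K" for C
    using joined dis that by blast
  then obtain C where C: "closedin X C" "closedin X (K - C)" "S \<subseteq> C" "C \<subseteq> K" "C \<inter> Q = {}"
    using clopen_separation[OF X K(1) S Q(1)] by (metis (no_types, lifting))
  have "W \<inter> T = {} \<or> W \<inter> C = {}" if W: "connectedin X W" "W \<subseteq> L" for W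
  proof (rule ccontr)
    assume "\<not> ?thesis"
    then obtain c where c: "W \<inter> T \<noteq> {}" "c \<in> W" "c \<in> C"
      by blast
    \<comment> \<open>\<open>W\<close> is connected and meets \<open>T\<close>, hence meets the
      clopen set \<open>D\<close> and cannot leave it inside \<open>L\<close>.\<close>
    have "W \<subseteq> D" if "D \<in> \<D>" for D
    proof -
      have D: "closedin X D" "closedin X (L - D)" "T \<subseteq> D"
        using that by (auto simp: \<D>_def)
      have "W \<inter> (L - D) = {}"
        using W D c unfolding connectedin_closedin by blast
      then show ?thesis
        using W by blast
    qed
    then have "c \<in> Q"
      using c by (auto simp: Q_def)
    then show False
      using c C by blast
  qed
  then obtain D where "closedin X D" "closedin X (L - D)" "T \<subseteq> D" "D \<subseteq> L" "D \<inter> C = {}"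
    using clopen_separation[OF X K(2) T C(1)] by (metis (no_types, lifting))
  with C that show thesis
    by blast
qed

section \<open>Construction of the closed cover\<close>

text \<open>Take a disjoint clopen pair \<open>C\<close>, \<open>D\<close> in the complements of
  \<open>V\<close> and \<open>U\<close>, and thicken it by normality to open sets \<open>P\<close>
  and \<open>Q\<close> with disjoint closures. The cover consists of the closure of \<open>P\<close>
  with \<open>A\<close> added, the closure of \<open>Q\<close> with \<open>B\<close> added, and the
  complement of \<open>P\<close> and \<open>Q\<close>.\<close>

lemma crooked_spaceI:
  assumes X: "compact_space X" "Hausdorff_space X"
    and A: "closedin X A" "A \<subseteq> U" and B: "closedin X B" "B \<subseteq> V"
    and UV: "openin X U" "openin X V"
    and dis: "\<And>C D. \<lbrakk>connectedin X C; C \<inter> V = {}; C \<inter> A \<noteq> {}; connectedin X D; D \<inter> U = {}; D \<inter> B \<noteq> {}\<rbrakk>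
                \<Longrightarrow> C \<inter> D = {}"
  shows "crooked_space X A B U V"
proof -
  have dis': "C \<inter> D = {}" if "connectedin X C" "C \<subseteq> topspace X - V" "C \<inter> (A - V) \<noteq> {}"
    "connectedin X D" "D \<subseteq> topspace X - U" "D \<inter> (B - U) \<noteq> {}" for C D
    by (rule dis) (use that in auto)
  have sub: "A - V \<subseteq> topspace X - V" "B - U \<subseteq> topspace X - U"
    using A B closedin_subset by blast+
  have cl: "closedin X (topspace X - V)" "closedin X (topspace X - U)"
    "closedin X (A - V)" "closedin X (B - U)"
    using A B UV by (auto intro: closedin_diff)
  obtain C D where C: "closedin X C" "closedin X (topspace X - V - C)" "A - V \<subseteq> C"
      "C \<subseteq> topspace X - V"
    and D: "closedin X D" "closedin X (topspace X - U - D)" "B - U \<subseteq> D" "D \<subseteq> topspace X - U"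
    and CD: "C \<inter> D = {}"
    by (rule disjoint_clopen_pair[OF X cl(1-3) sub(1) cl(4) sub(2)], rule dis', assumption+)
  have "normal_space X"
    using X compact_Hausdorff_or_regular_imp_normal_space by blast
  then have normal: "\<And>S U. closedin X S \<Longrightarrow> openin X U \<Longrightarrow> S \<subseteq> U \<Longrightarrow>
      \<exists>V. openin X V \<and> S \<subseteq> V \<and> X closure_of V \<subseteq> U"
    unfolding normal_space_alt by blast
  have shrink: "\<exists>O'. openin X O' \<and> S \<subseteq> O' \<and> X closure_of O' \<inter> T = {}"
    if S: "closedin X S" and T: "closedin X T" and ST: "S \<inter> T = {}" for S T
  proof -
    have sub: "S \<subseteq> topspace X - T"
      using closedin_subset[OF S] ST by blast
    have op: "openin X (topspace X - T)"
      using T by (simp add: closedin_def)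
    obtain O' where "openin X O'" "S \<subseteq> O'" "X closure_of O' \<subseteq> topspace X - T"
      using normal[OF S op sub] by metis
    then show ?thesis
      by (intro exI[of _ O']) auto
  qed
  \<comment> \<open>The closure of \<open>P\<close> has to miss the rest of the complement of
    \<open>V\<close>, and also \<open>D\<close>, to leave room for \<open>Q\<close>.\<close>
  have P': "closedin X ((topspace X - V - C) \<union> D)" "C \<inter> ((topspace X - V - C) \<union> D) = {}"
    using CD by (simp_all add: closedin_Un C D) blast
  obtain P where P: "openin X P" "C \<subseteq> P" "X closure_of P \<inter> ((topspace X - V - C) \<union> D) = {}"
    using shrink[OF C(1) P'] by blast
  have Q': "closedin X ((topspace X - U - D) \<union> X closure_of P)"
    "D \<inter> ((topspace X - U - D) \<union> X closure_of P) = {}"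
    using P(3) by (simp_all add: closedin_Un D) blast
  obtain Q where Q: "openin X Q" "D \<subseteq> Q" "X closure_of Q \<inter> ((topspace X - U - D) \<union> X closure_of P) = {}"
    using shrink[OF D(1) Q'] by blast
  have PQ: "P \<subseteq> X closure_of P" "Q \<subseteq> X closure_of Q" "X closure_of P \<subseteq> topspace X"
    "X closure_of Q \<subseteq> topspace X"
    using P Q by (auto simp: closure_of_subset openin_subset closure_of_subset_topspace)
  have AB: "A \<subseteq> topspace X" "B \<subseteq> topspace X"
    using A B closedin_subset by blast+
  show ?thesis
    unfolding crooked_space_def
  proof (intro exI conjI)
    show "closedin X (X closure_of P \<union> A)"
      using A by (simp add: closedin_Un)
    show "closedin X (topspace X - (P \<union> Q))"
      using P Q by (auto intro: closedin_diff)
    show "closedin X (X closure_of Q \<union> B)"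
      using B by (simp add: closedin_Un)
    show "topspace X = X closure_of P \<union> A \<union> (topspace X - (P \<union> Q)) \<union> (X closure_of Q \<union> B)"
      using PQ AB by blast
    \<comment> \<open>Outside \<open>V\<close>, the closure of \<open>P\<close> is contained in
      \<open>C\<close>, and so is \<open>A\<close>. But \<open>C\<close> lies in \<open>P\<close>,
      which is removed here.\<close>
    show "(X closure_of P \<union> A) \<inter> (topspace X - (P \<union> Q)) \<subseteq> V"
      using P(2,3) C(3) by blast
    show "(X closure_of Q \<union> B) \<inter> (topspace X - (P \<union> Q)) \<subseteq> U"
      using Q(2,3) D(3) by blast
    have "X closure_of P \<inter> X closure_of Q = {}"
      using Q(3) by blast
    \<comment> \<open>A point of \<open>B\<close> outside \<open>U\<close> lies in \<open>D\<close>,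
      hence in \<open>Q\<close>, away from the closure of \<open>P\<close>. The other inclusion is
      symmetric.\<close>
    moreover have "X closure_of P \<inter> B \<subseteq> U" "X closure_of Q \<inter> A \<subseteq> V"
      using calculation P(2) Q(2) PQ C(3) D(3) by blast+
    ultimately show "(X closure_of P \<union> A) \<inter> (X closure_of Q \<union> B) \<subseteq> U \<inter> V"
      using A(2) B(2) by blast
  qed blast+
qed

section \<open>From arcs to crookedness\<close>

text \<open>The closed sets \<open>A\<close> and \<open>B\<close> can be replaced by single points:
  a set that avoids the preimage of \<open>nbhd Y \<epsilon> B\<close> has its images at distance at
  least \<epsilon> from \<open>f y\<close> for each \<open>y\<close> sent into \<open>B\<close>. The
  same holds with \<open>A\<close> and \<open>x\<close>.\<close>

lemma eps_crookedI:
  assumes X: "compact_space X" "Hausdorff_space X" and f: "continuous_map X (top_of_set Y) f"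
    and "0 < \<epsilon>"
    and dis: "\<And>C D x y z. \<lbrakk>connectedin X C; connectedin X D; x \<in> C; y \<in> D; z \<in> C; z \<in> D\<rbrakk>
      \<Longrightarrow> (\<exists>c\<in>C. dist (f c) (f y) < \<epsilon>) \<or> (\<exists>d\<in>D. dist (f x) (f d) < \<epsilon>)"
  shows "eps_crooked X Y \<epsilon> f"
  unfolding eps_crooked_def eps_crooked_at_def crooked_map_def
proof (intro allI impI, elim conjE)
  fix A B
  assume AB: "closedin (top_of_set Y) A" "closedin (top_of_set Y) B"
  have eq: "topspace X \<inter> f -` S = {x \<in> topspace X. f x \<in> S}" for S
    by auto
  have fY: "f x \<in> Y" if "x \<in> topspace X" for x
    using continuous_map_image_subset_topspace[OF f] that by auto
  have AB': "A \<subseteq> nbhd Y \<epsilon> A" "B \<subseteq> nbhd Y \<epsilon> B"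
    using AB \<open>0 < \<epsilon>\<close> by (simp_all add: closedin_imp_subset subset_nbhd)
  show "crooked_space X (topspace X \<inter> f -` A) (topspace X \<inter> f -` B)
      (topspace X \<inter> f -` nbhd Y \<epsilon> A) (topspace X \<inter> f -` nbhd Y \<epsilon> B)"
    unfolding eq
  proof (rule crooked_spaceI[OF X])
    fix C D
    assume C: "connectedin X C" "C \<inter> {x \<in> topspace X. f x \<in> nbhd Y \<epsilon> B} = {}"
        "C \<inter> {x \<in> topspace X. f x \<in> A} \<noteq> {}"
      and D: "connectedin X D" "D \<inter> {x \<in> topspace X. f x \<in> nbhd Y \<epsilon> A} = {}"
        "D \<inter> {x \<in> topspace X. f x \<in> B} \<noteq> {}"
    obtain x y where xy: "x \<in> C" "f x \<in> A" "y \<in> D" "f y \<in> B"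
      using C D by auto
    have CD: "C \<subseteq> topspace X" "D \<subseteq> topspace X"
      using C D by (auto dest: connectedin_subset_topspace)
    have "\<not> dist (f c) (f y) < \<epsilon>" if "c \<in> C" for c
      using nbhd_dist[of "f c" Y "f y" B \<epsilon>] fY C CD xy that by (auto simp: dist_commute)
    moreover have "\<not> dist (f x) (f d) < \<epsilon>" if "d \<in> D" for d
      using nbhd_dist[of "f d" Y "f x" A \<epsilon>] fY D CD xy that by (auto simp: dist_commute)
    ultimately have "z \<notin> D" if "z \<in> C" for z
      using dis[OF C(1) D(1) xy(1,3) that] by blast
    then show "C \<inter> D = {}"
      by blast
  next
    show "closedin X {x \<in> topspace X. f x \<in> A}" "closedin X {x \<in> topspace X. f x \<in> B}"
      using AB by (auto intro: closedin_continuous_map_preimage[OF f])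
    show "openin X {x \<in> topspace X. f x \<in> nbhd Y \<epsilon> A}" "openin X {x \<in> topspace X. f x \<in> nbhd Y \<epsilon> B}"
      by (intro openin_continuous_map_preimage[OF f] openin_nbhd)+
  qed (use AB' in blast)+
qed

text \<open>Follow \<open>g\<close> up to its first point on \<open>h\<close>, then switch to \<open>h\<close>.\<close>

lemma arc_switch:
  fixes g h :: "real \<Rightarrow> 'a::real_normed_vector"
  assumes g: "arc g" and h: "arc h" and gh: "pathfinish g = pathstart h"
    and g0: "pathstart g \<notin> path_image h" and h1: "pathfinish h \<notin> path_image g"
  obtains k where "arc k" "pathstart k = pathstart g" "pathfinish k = pathfinish h"
    "k ` {0..1/2} \<subseteq> path_image g" "k ` {1/2..1} \<subseteq> path_image h"
proof -
  define T where "T = {0..1} \<inter> g -` path_image h"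
  have "continuous_on {0..1} g"
    using g by (simp add: arc_def path_def)
  moreover have "closed (path_image h)"
    using h by (simp add: closed_arc_image)
  ultimately have "closed T"
    unfolding T_def by (intro continuous_closed_preimage) auto
  then have "compact T"
    by (simp add: T_def compact_eq_bounded_closed bounded_Int)
  moreover have "1 \<in> T"
    using gh by (auto simp: T_def pathfinish_def)
  ultimately obtain t where t: "t \<in> T" and tmin: "\<And>u. u \<in> T \<Longrightarrow> t \<le> u"
    using compact_attains_inf[of T] by auto
  then obtain s where s: "s \<in> {0..1}" "g t = h s"
    by (auto simp: T_def path_image_def)
  have "g t \<in> path_image g"
    using t by (auto simp: T_def path_image_def)
  \<comment> \<open>Since \<open>g\<close> starts off \<open>h\<close> and \<open>h\<close> ends off
    \<open>g\<close>, neither piece is degenerate, so both subpaths are arcs.\<close>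
  then have t01: "t \<in> {0..1}" "t \<noteq> 0" and s1: "s \<noteq> 1"
    using t g0 h1 s by (auto simp: T_def pathstart_def pathfinish_def)
  define k where "k = subpath 0 t g +++ subpath s 1 h"
  have img: "path_image (subpath 0 t g) = g ` {0..t}" "path_image (subpath s 1 h) = h ` {s..1}"
    using t01 s by (auto simp: path_image_subpath)
  \<comment> \<open>Minimality of \<open>t\<close> makes the junction the only common point of the
    two pieces.\<close>
  have "g u = h s" if *: "u \<in> {0..t}" "v \<in> {s..1}" "g u = h v" for u v
  proof -
    have "u \<in> T"
      using * t01 s by (auto simp: T_def path_image_def)
    then have "u = t"
      using tmin * by force
    then show ?thesis
      using s by simp
  qed
  then have "g ` {0..t} \<inter> h ` {s..1} \<subseteq> {h s}"
    by blast
  then have "arc k"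
    unfolding k_def using t01 s s1
    by (intro arc_join arc_subpath_arc g h; simp only: img) (auto simp: pathstart_def pathfinish_def subpath_def)
  moreover have "k ` {0..1/2} \<subseteq> path_image g"
  proof clarify
    fix u :: real
    assume u: "u \<in> {0..1/2}"
    then have "2 * u * t \<in> {0..1}"
      using t01 mult_le_one[of "2 * u" t] by auto
    then show "k u \<in> path_image g"
      using u by (auto simp: k_def joinpaths_def subpath_def path_image_def mult_ac)
  qed
  moreover have "k ` {1/2..1} \<subseteq> path_image h"
  proof clarify
    fix u :: real
    assume u: "u \<in> {1/2..1}"
    show "k u \<in> path_image h"
    \<comment> \<open>At 1/2 \<open>joinpaths\<close> still takes its first branch, so the value is
      \<open>g t\<close>, which is on \<open>h\<close> because it equals \<open>h s\<close>.\<close>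
    proof (cases "u = 1/2")
      case True
      have "k u = g t"
        unfolding True by (simp add: k_def joinpaths_def subpath_def)
      then show ?thesis
        using s by (simp add: path_image_def)
    next
      case False
      have "(1 - s) * (2 * u - 1) \<in> {0..1 - s}"
        using u s mult_left_le[of "2 * u - 1" "1 - s"] by auto
      then have "(1 - s) * (2 * u - 1) + s \<in> {0..1}"
        using s by auto
      then show ?thesis
        using False u by (auto simp: k_def joinpaths_def subpath_def path_image_def)
    qed
  qed
  ultimately show thesis
    using that by (simp add: k_def pathstart_def pathfinish_def subpath_def joinpaths_def)
qed

text \<open>If the criterion of \<open>eps_crookedI\<close> failed for \<open>C\<close> and
  \<open>D\<close>, an arc from \<open>x\<close> to \<open>z\<close> in the closure of
  \<open>C\<close> and one from \<open>z\<close> to \<open>y\<close> in the closure of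
  \<open>D\<close> could be spliced into an arc that violates \<open>arcs\<close>.\<close>

lemma eps_crooked_if_arcs:
  fixes Z :: "'a::euclidean_space set" and Y :: "'b::metric_space set"
  assumes Z: "compact Z"
    and pc: "\<And>C. \<lbrakk>C \<subseteq> Z; compact C; connected C\<rbrakk> \<Longrightarrow> path_connected C"
    and f: "continuous_map (top_of_set Z) (top_of_set Y) f" and \<epsilon>: "0 < \<epsilon>"
    and arcs: "\<And>k. \<lbrakk>arc k; path_image k \<subseteq> Z\<rbrakk> \<Longrightarrow>
      \<exists>s t. 0 \<le> s \<and> s \<le> t \<and> t \<le> 1 \<and> dist (f (k 0)) (f (k t)) < \<epsilon> \<and> dist (f (k 1)) (f (k s)) < \<epsilon>"
  shows "eps_crooked (top_of_set Z) Y \<epsilon> f"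
proof (rule eps_crookedI)
  show "compact_space (top_of_set Z)"
    using Z by (simp add: compact_space_subtopology)
  show "Hausdorff_space (top_of_set Z)"
    by (simp add: Hausdorff_space_subtopology)
  fix C D :: "'a set" and x y z
  assume "connectedin (top_of_set Z) C" "connectedin (top_of_set Z) D"
    and xyz: "x \<in> C" "y \<in> D" "z \<in> C" "z \<in> D"
  then have C: "connected C" "C \<subseteq> Z" and D: "connected D" "D \<subseteq> Z"
    by (auto simp: connectedin_subtopology)
  have contf: "continuous_on Z f"
    using f by simp
  show "(\<exists>c\<in>C. dist (f c) (f y) < \<epsilon>) \<or> (\<exists>d\<in>D. dist (f x) (f d) < \<epsilon>)"
  proof (rule ccontr)
    assume neg: "\<not> ?thesis"
    have closZ: "closure C \<subseteq> Z" "closure D \<subseteq> Z"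
      using C D Z by (auto simp: closure_minimal compact_imp_closed)
    then have "path_connected (closure C)" "path_connected (closure D)"
      using C D Z by (auto intro!: pc connected_imp_connected_closure simp: compact_closure intro: bounded_subset[OF compact_imp_bounded])
    \<comment> \<open>The lower bound on the distance is a closed condition, so it passes from
      \<open>C\<close> to its closure.\<close>
    have farC: "\<epsilon> \<le> dist (f c) (f y)" if "c \<in> closure C" for c
    proof -
      have "closed {c \<in> Z. \<epsilon> \<le> dist (f c) (f y)}"
        using Z by (intro continuous_on_closed_Collect_le continuous_intros contf compact_imp_closed)
      moreover have "C \<subseteq> {c \<in> Z. \<epsilon> \<le> dist (f c) (f y)}"
        using neg C by (auto simp: not_less)
      ultimately show ?thesis
        using that closure_minimal by blast
    qed
    have farD: "\<epsilon> \<le> dist (f x) (f d)" if "d \<in> closure D" for d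
    proof -
      have "closed {d \<in> Z. \<epsilon> \<le> dist (f x) (f d)}"
        using Z by (intro continuous_on_closed_Collect_le continuous_intros contf compact_imp_closed)
      moreover have "D \<subseteq> {d \<in> Z. \<epsilon> \<le> dist (f x) (f d)}"
        using neg D by (auto simp: not_less)
      ultimately show ?thesis
        using that closure_minimal by blast
    qed
    have cl: "x \<in> closure C" "z \<in> closure C" "z \<in> closure D" "y \<in> closure D"
      using xyz closure_subset by blast+
    \<comment> \<open>These are the end point conditions of \<open>arc_switch\<close>; they also
      keep \<open>x\<close> and \<open>y\<close> distinct from \<open>z\<close>, as arcs
      require.\<close>
    have x: "x \<notin> closure D" and y: "y \<notin> closure C"
      using farC[of y] farD[of x] \<epsilon> by auto
    obtain g where g: "arc g" "path_image g \<subseteq> closure C" "pathstart g = x" "pathfinish g = z"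
      using \<open>path_connected (closure C)\<close> cl x unfolding path_connected_arcwise by metis
    obtain h where h: "arc h" "path_image h \<subseteq> closure D" "pathstart h = z" "pathfinish h = y"
      using \<open>path_connected (closure D)\<close> cl y unfolding path_connected_arcwise by metis
    obtain k where k: "arc k" "pathstart k = x" "pathfinish k = y"
      and kg: "k ` {0..1/2} \<subseteq> path_image g" and kh: "k ` {1/2..1} \<subseteq> path_image h"
      using arc_switch[of g h] g h x y by (metis subsetD)
    have "{0..1::real} = {0..1/2} \<union> {1/2..1}"
      by auto
    then have "path_image k \<subseteq> Z"
      using kg kh g h closZ unfolding path_image_def by blast
    then obtain s t where st: "0 \<le> s" "s \<le> t" "t \<le> 1"
        "dist (f x) (f (k t)) < \<epsilon>" "dist (f y) (f (k s)) < \<epsilon>"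
      using arcs[OF \<open>arc k\<close>] k by (auto simp: pathstart_def pathfinish_def)
    \<comment> \<open>Closeness to \<open>f x\<close> forces \<open>t < 1/2\<close> and closeness to
      \<open>f y\<close> forces \<open>s > 1/2\<close>, against \<open>s \<le> t\<close>.\<close>
    have "k t \<notin> closure D" "k s \<notin> closure C"
      using farC[of "k s"] farD[of "k t"] st by (auto simp: dist_commute)
    then have "t \<notin> {1/2..1}" "s \<notin> {0..1/2}"
      using kg kh g(2) h(2) by blast+
    then show False
      using st by auto
  qed
qed (use f \<epsilon> in auto)

section \<open>Connected closed subsets of graphs\<close>

text \<open>Pulled back to the unit interval, \<open>K\<close> becomes a connected set of reals,
  that is, an interval.\<close>

lemma connected_subset_arc_path_connected:
  fixes e :: "real \<Rightarrow> 'a::t2_space"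
  assumes "arc e" "K \<subseteq> path_image e" "connected K"
  shows "path_connected K"
proof -
  obtain h where h: "homeomorphism {0..1} (path_image e) e h"
    using homeomorphism_arc[OF \<open>arc e\<close>] by blast
  have eh: "e (h x) = x" if "x \<in> K" for x
    using homeomorphism_apply2[OF h] assms(2) that by blast
  have hK: "h ` K \<subseteq> {0..1}"
    using homeomorphism_image2[OF h] assms(2) by blast
  have "connected (h ` K)"
    using homeomorphism_cont2[OF h] assms(2,3)
    by (meson connected_continuous_image continuous_on_subset)
  then have "path_connected (h ` K)"
    by (simp add: is_interval_connected_1[symmetric] is_interval_path_connected)
  moreover have "continuous_on (h ` K) e"
    using homeomorphism_cont1[OF h] hK continuous_on_subset by blast
  ultimately have "path_connected (e ` h ` K)"
    by (rule path_connected_continuous_image[rotated])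
  moreover have "e ` h ` K = K"
    using eh by force
  ultimately show ?thesis
    by simp
qed

text \<open>Two points of the edge outside \<open>K\<close>, one on each side of \<open>e v\<close>, would disconnect \<open>K\<close>.\<close>

lemma connected_reaches_edge_end:
  fixes e :: "real \<Rightarrow> 'a::t2_space"
  assumes e: "arc e" and op: "openin (top_of_set Z) (e ` {0<..<1})"
    and K: "K \<subseteq> Z" "closed K" "connected K" "\<not> K \<subseteq> path_image e"
    and v: "v \<in> {0..1}" "e v \<in> K"
  shows "e ` {0..v} \<subseteq> K \<or> e ` {v..1} \<subseteq> K"
proof (rule ccontr)
  assume "\<not> ?thesis"
  then obtain u w where uw: "u \<in> {0..v}" "e u \<notin> K" "w \<in> {v..1}" "e w \<notin> K"
    by blast
  have inj: "inj_on e {0..1}"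
    using e by (simp add: arc_def)
  have cl: "closed (e ` {a..b})" if "0 \<le> a" "b \<le> 1" for a b
  proof -
    have "continuous_on {a..b} e"
      using e that unfolding arc_def path_def by (auto intro: continuous_on_subset)
    then show ?thesis
      by (intro compact_imp_closed compact_continuous_image) auto
  qed
  \<comment> \<open>\<open>M\<close> is the part of \<open>K\<close> between the gaps
    \<open>u\<close> and \<open>w\<close>, and \<open>N\<close> is the rest. \<open>N\<close> is
    closed because the open edge is relatively open in \<open>Z\<close>.\<close>
  define M where "M = K \<inter> e ` {u..w}"
  define N where "N = (K - e ` {0<..<1}) \<union> (K \<inter> e ` {0..u}) \<union> (K \<inter> e ` {w..1})"
  obtain T where T: "open T" "e ` {0<..<1} = Z \<inter> T"
    using op by (auto simp: openin_open)
  have "K - e ` {0<..<1} = K - T"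
    using K T by blast
  then have "closed N"
    unfolding N_def using K T uw v by (auto intro!: closed_Un closed_Diff closed_Int cl)
  moreover have "closed M"
    unfolding M_def using K uw v by (auto intro!: closed_Int cl)
  moreover have "M \<inter> N \<inter> K = {}"
  proof -
    have False if p: "p \<in> {u..w}" "e p \<in> K" "e p \<in> N" for p
    proof -
      have p01: "p \<in> {0..1}" and "p \<noteq> u" "p \<noteq> w"
        using p uw v by auto
      then have "p \<in> {0<..<1}"
        using p uw v by auto
      then have "e p \<in> e ` ({0..u} \<union> {w..1})"
        using p unfolding N_def image_Un by blast
      then obtain q where q: "q \<in> {0..u} \<union> {w..1}" "e p = e q"
        by blast
      then have "p = q"
        using inj_onD[OF inj] p01 uw v by auto
      then show False
        using q p \<open>p \<noteq> u\<close> \<open>p \<noteq> w\<close> by auto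
    qed
    then show ?thesis
      unfolding M_def by blast
  qed
  moreover have "K \<subseteq> M \<union> N"
  proof
    fix x
    assume "x \<in> K"
    show "x \<in> M \<union> N"
    proof (cases "x \<in> e ` {0<..<1}")
      case True
      then obtain p where "p \<in> {0<..<1}" "x = e p"
        by blast
      moreover consider "p \<in> {0..u}" | "p \<in> {u..w}" | "p \<in> {w..1}"
        using \<open>p \<in> {0<..<1}\<close> by force
      ultimately show ?thesis
        using \<open>x \<in> K\<close> unfolding M_def N_def by cases blast+
    qed (use \<open>x \<in> K\<close> in \<open>auto simp: N_def\<close>)
  qed
  ultimately have "M \<inter> K = {} \<or> N \<inter> K = {}"
    using K by (intro connected_closedD) auto
  moreover have "e v \<in> M"
    using v uw by (auto simp: M_def)
  \<comment> \<open>\<open>M\<close> contains \<open>e v\<close>, so connectedness leaves nothing in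
    \<open>N\<close>; then \<open>K\<close> would lie on the single edge \<open>e\<close>.\<close>
  ultimately have "K \<subseteq> M"
    using v \<open>K \<subseteq> M \<union> N\<close> by blast
  then show False
    using K(4) uw v by (auto simp: M_def path_image_def image_subset_iff)
qed

text \<open>A time qualifies exactly when it is in the preimage \<open>T\<close> of \<open>K\<close>
  and no time outside \<open>T\<close> precedes it. This is an intersection of \<open>T\<close> with
  closed half-lines.\<close>

lemma compact_initial_times:
  fixes e :: "real \<Rightarrow> 'a::topological_space"
  assumes "path e" "closed K"
  shows "compact {v \<in> {0..1}. e ` {0..v} \<subseteq> K}"
proof -
  define T where "T = {0..1} \<inter> e -` K"
  have "closed T"
    unfolding T_def using assms by (intro continuous_closed_preimage) (auto simp: path_def)
  have "{v \<in> {0..1}. e ` {0..v} \<subseteq> K} = {0..1} \<inter> (T \<inter> (\<Inter>u\<in>{0..1} - T. {..u}))"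
  proof (intro equalityI subsetI)
    fix v
    assume v: "v \<in> {0..1} \<inter> (T \<inter> (\<Inter>u\<in>{0..1} - T. {..u}))"
    have "u \<in> T" if "u \<in> {0..v}" for u
    proof (rule ccontr)
      assume "u \<notin> T"
      then have "v \<le> u"
        using v that by auto
      then show False
        using v that \<open>u \<notin> T\<close> by auto
    qed
    then show "v \<in> {v \<in> {0..1}. e ` {0..v} \<subseteq> K}"
      using v by (auto simp: T_def)
  next
    fix v
    assume v: "v \<in> {v \<in> {0..1}. e ` {0..v} \<subseteq> K}"
    then have "u \<in> T" if "u \<in> {0..v}" for u
      using that by (auto simp: T_def)
    then show "v \<in> {0..1} \<inter> (T \<inter> (\<Inter>u\<in>{0..1} - T. {..u}))"
      using v by force
  qed
  moreover have "closed (T \<inter> (\<Inter>u\<in>{0..1} - T. {..u}))"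
    using \<open>closed T\<close> by (intro closed_Int closed_INT) auto
  ultimately show ?thesis
    by (metis compact_Icc compact_Int_closed)
qed

lemma path_component_along_path:
  assumes "path e" "e ` {0..v} \<subseteq> K" "v \<in> {0..1}"
  shows "path_component K (e 0) (e v)"
proof -
  have "path_connected (e ` {0..v})"
    using assms by (intro path_connected_continuous_image)
      (auto simp: path_def is_interval_path_connected is_interval_cc intro: continuous_on_subset)
  then have "path_component (e ` {0..v}) (e 0) (e v)"
    using assms(3) by (auto simp: path_connected_component)
  then show ?thesis
    using assms(2) path_component_of_subset by blast
qed

text \<open>
  A path component of \<open>K\<close> is a finite union of vertices and initial segments of edges, hence
  closed. Since \<open>E\<close> is closed under reversal, final segments need no separate treatment.
\<close>

lemma finite_graph_path_connected:
  fixes Z :: "'a::t2_space set"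
  assumes fin: "finite V" "finite E" and Z: "Z = V \<union> (\<Union>e\<in>E. path_image e)"
    and E: "\<And>e. e \<in> E \<Longrightarrow> arc e" "\<And>e. e \<in> E \<Longrightarrow> reversepath e \<in> E"
      "\<And>e. e \<in> E \<Longrightarrow> pathstart e \<in> V"
      "\<And>e. e \<in> E \<Longrightarrow> openin (top_of_set Z) (e ` {0<..<1})"
    and K: "K \<subseteq> Z" "closed K" "connected K"
  shows "path_connected K"
proof (cases "\<exists>e\<in>E. K \<subseteq> path_image e")
  case True
  then show ?thesis
    using connected_subset_arc_path_connected E(1) K(3) by blast
next
  case False
  \<comment> \<open>\<open>I e\<close> collects the times up to which the edge, run from its start,
    has stayed in \<open>K\<close>.\<close>
  define I where "I e = {v \<in> {0..1}. e ` {0..v} \<subseteq> K}" for e :: "real \<Rightarrow> 'a"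
  have initial: "\<exists>e\<in>E. x \<in> e ` I e" if x: "x \<in> K" "x \<notin> V" for x
  proof -
    obtain e v where e: "e \<in> E" "v \<in> {0..1}" "x = e v"
      using x K Z by (auto simp: path_image_def)
    then consider "e ` {0..v} \<subseteq> K" | "e ` {v..1} \<subseteq> K"
      using connected_reaches_edge_end[OF E(1) E(4) K, of e v] x False by blast
    then show ?thesis
    proof cases
      case 1
      then show ?thesis
        using e by (auto simp: I_def)
    next
      case 2
      have "reversepath e ` {0..1 - v} \<subseteq> K"
        using 2 by (auto simp: reversepath_def image_subset_iff)
      then have "1 - v \<in> I (reversepath e)"
        using e by (auto simp: I_def)
      moreover have "x = reversepath e (1 - v)"
        using e by (simp add: reversepath_def)
      ultimately show ?thesis
        using E(2) e by blast
    qed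
  qed
  have start: "path_component K (e 0) x" "e 0 \<in> V" "e 0 \<in> K" if "e \<in> E" "x \<in> e ` I e" for e x
  proof -
    show "path_component K (e 0) x"
      using path_component_along_path[of e _ K] E(1) that by (auto simp: I_def arc_imp_path)
    then show "e 0 \<in> K"
      by (rule path_component_mem)
    show "e 0 \<in> V"
      using E(3) that by (auto simp: pathstart_def)
  qed
  have closed_comp: "closed {x. path_component K p x}" for p
  proof -
    let ?P = "{x. path_component K p x}"
    \<comment> \<open>An initial segment is joined to its starting vertex within \<open>K\<close>,
      so it lies in the component of \<open>p\<close> as soon as that vertex does. Finitely many
      closed pieces result.\<close>
    have eq: "?P = (V \<inter> ?P) \<union> (\<Union>e\<in>{e\<in>E. e 0 \<in> ?P}. e ` I e)"
    proof (intro equalityI subsetI)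
      fix x
      assume x: "x \<in> ?P"
      show "x \<in> (V \<inter> ?P) \<union> (\<Union>e\<in>{e\<in>E. e 0 \<in> ?P}. e ` I e)"
      proof (cases "x \<in> V")
        case False
        have "path_component K p x"
          using x by simp
        then obtain e where e: "e \<in> E" "x \<in> e ` I e"
          using initial[OF _ False] path_component_mem(2) by metis
        have "path_component K p (e 0)"
          using \<open>path_component K p x\<close> path_component_sym[OF start(1)[OF e]] by (rule path_component_trans)
        with e show ?thesis
          by blast
      qed (use x in blast)
    next
      fix x
      assume "x \<in> (V \<inter> ?P) \<union> (\<Union>e\<in>{e\<in>E. e 0 \<in> ?P}. e ` I e)"
      then consider "x \<in> ?P" | e where "e \<in> E" "path_component K p (e 0)" "x \<in> e ` I e"
        by blast
      then show "x \<in> ?P"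
      proof cases
        case 2
        then show ?thesis
          using path_component_trans[OF 2(2) start(1)[OF 2(1,3)]] by simp
      qed
    qed
    have closed_I: "closed (e ` I e)" if "e \<in> E" for e
    proof -
      have "path e"
        using E(1) that arc_imp_path by blast
      then have "continuous_on (I e) e"
        unfolding path_def I_def by (rule continuous_on_subset) auto
      then show ?thesis
        using compact_initial_times[OF \<open>path e\<close> K(2)]
        by (intro compact_imp_closed compact_continuous_image) (simp_all add: I_def)
    qed
    have "closed (V \<inter> ?P)"
      using fin by (simp add: finite_imp_closed)
    moreover have "closed (\<Union>e\<in>{e\<in>E. e 0 \<in> ?P}. e ` I e)"
      using fin closed_I by (intro closed_UN) auto
    ultimately have "closed ((V \<inter> ?P) \<union> (\<Union>e\<in>{e\<in>E. e 0 \<in> ?P}. e ` I e))"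
      by (rule closed_Un)
    then show ?thesis
      by (subst eq)
  qed
  have vertex: "\<exists>p\<in>V \<inter> K. path_component K p x" if "x \<in> K" for x
  proof (cases "x \<in> V")
    case True
    then show ?thesis
      using that path_component_refl by blast
  next
    case False
    then show ?thesis
      using initial[OF that False] start by blast
  qed
  \<comment> \<open>By \<open>vertex\<close> every component contains a vertex, so those other than
    the component of \<open>x\<close> have a closed union \<open>?N\<close>. Connectedness of
    \<open>K\<close> makes it miss \<open>K\<close>.\<close>
  have "path_component K x y" if "x \<in> K" "y \<in> K" for x y
  proof -
    let ?M = "{z. path_component K x z}"
    let ?N = "\<Union>p\<in>V - ?M. {z. path_component K p z}"
    have "closed ?N"
      using fin closed_comp by (intro closed_UN) auto
    moreover have "?M \<inter> ?N = {}"
    proof -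
      have "path_component K x p" if "path_component K x z" "path_component K p z" for p z
        using that path_component_sym path_component_trans by metis
      then show ?thesis
        by blast
    qed
    moreover have cover: "K \<subseteq> ?M \<union> ?N"
    proof
      fix z
      assume "z \<in> K"
      then obtain p where "p \<in> V" "path_component K p z"
        using vertex by blast
      then show "z \<in> ?M \<union> ?N"
        using path_component_trans[of K x p z] by (cases "path_component K x p") auto
    qed
    ultimately have "?M \<inter> K = {} \<or> ?N \<inter> K = {}"
      using closed_comp K(3) by (intro connected_closedD) auto
    moreover have "x \<in> ?M \<inter> K"
      using that path_component_refl by blast
    ultimately show ?thesis
      using that cover by blast
  qed
  then show ?thesis
    by (simp add: path_connected_component)
qed

text \<open>The vertices and segments of the complex form a finite graph as above. The main point is
  that open segments are relatively open in the polyhedron.\<close>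

lemma simplicial_complex_dim_1_path_connected:
  fixes \<C> :: "'a::euclidean_space set set"
  assumes "simplicial_complex \<C>" and dim: "\<And>S. S \<in> \<C> \<Longrightarrow> aff_dim S \<le> 1"
    and K: "K \<subseteq> \<Union>\<C>" "closed K" "connected K"
  shows "path_connected K"
proof -
  have fin: "finite \<C>" and simp: "\<And>S. S \<in> \<C> \<Longrightarrow> \<exists>n. n simplex S"
    and face: "\<And>F S. S \<in> \<C> \<Longrightarrow> F face_of S \<Longrightarrow> F \<in> \<C>"
    and int: "\<And>S S'. S \<in> \<C> \<Longrightarrow> S' \<in> \<C> \<Longrightarrow> (S \<inter> S') face_of S"
    using assms(1) unfolding simplicial_complex_def by blast+
  define V where "V = {a. {a} \<in> \<C>}"
  \<comment> \<open>Both orders of the end points occur, which makes \<open>E\<close> closed under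
    reversal.\<close>
  define E where "E = (\<lambda>(a, b). linepath a b) ` {(a, b) \<in> V \<times> V. a \<noteq> b \<and> closed_segment a b \<in> \<C>}"
  have "finite ((\<lambda>a. {a}) ` V)"
    using fin by (rule finite_subset[rotated]) (auto simp: V_def)
  then have finV: "finite V"
    by (rule finite_imageD) auto
  then have finE: "finite E"
    unfolding E_def by (intro finite_imageI finite_subset[OF _ finite_cartesian_product[of V V]]) auto
  have ends: "a \<in> V" "b \<in> V" if "closed_segment a b \<in> \<C>" for a b
    using face[OF that] by (auto simp: V_def face_of_singleton extreme_point_of_segment)
  have shape: "S = {} \<or> (\<exists>a. S = {a}) \<or> (\<exists>a b. a \<noteq> b \<and> S = closed_segment a b)" if S: "S \<in> \<C>" for S
  proof -
    obtain n where n: "n simplex S"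
      using simp S by blast
    \<comment> \<open>Dimension -1 is that of the empty simplex.\<close>
    have "-1 \<le> n" "n \<le> 1"
      using simplex_dim_ge[OF n] dim[OF S] aff_dim_simplex[OF n] by auto
    then consider "n = -1" | "n = 0" | "n = 1"
      by linarith
    then show ?thesis
    proof cases
      case 3
      then obtain C where C: "card C = 2" "S = convex hull C"
        using n by (auto simp: simplex_def)
      then obtain a b where "C = {a, b}" "a \<noteq> b"
        by (auto simp: card_2_iff)
      then show ?thesis
        using C by (auto simp: segment_convex_hull)
    qed (use n in \<open>auto simp: simplex_zero\<close>)
  qed
  have Z: "\<Union>\<C> = V \<union> (\<Union>e\<in>E. path_image e)"
  proof (intro equalityI subsetI)
    fix x
    assume "x \<in> \<Union>\<C>"
    then obtain S where S: "S \<in> \<C>" "x \<in> S"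
      by blast
    then consider "S = {x}" | a b where "a \<noteq> b" "S = closed_segment a b"
      using shape by blast
    then show "x \<in> V \<union> (\<Union>e\<in>E. path_image e)"
    proof cases
      case 1
      then show ?thesis
        using S by (simp add: V_def)
    next
      case 2
      then have "linepath a b \<in> E"
        using S ends[of a b] by (auto simp: E_def)
      then show ?thesis
        using 2 S by (metis UN_I UnI2 path_image_linepath)
    qed
  qed (auto simp: V_def E_def)
  have op: "openin (top_of_set (\<Union>\<C>)) (open_segment a b)"
    if ab: "a \<noteq> b" "closed_segment a b \<in> \<C>" for a b
  proof -
    let ?S = "closed_segment a b"
    \<comment> \<open>Another simplex that meets the open segment would have the whole segment as a
      proper face, hence dimension above 1.\<close>
    have "S \<inter> open_segment a b = {}" if S: "S \<in> \<C>" "S \<noteq> ?S" for S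
    proof (rule ccontr)
      assume "S \<inter> open_segment a b \<noteq> {}"
      then have "(?S \<inter> S) \<inter> rel_interior ?S \<noteq> {}"
        using ab by (auto simp: rel_interior_closed_segment open_segment_def)
      then have "?S \<inter> S = ?S"
        using face_of_disjoint_rel_interior[OF int[OF ab(2) S(1)]] by blast
      then have "?S face_of S"
        using int[OF S(1) ab(2)] by (simp add: Int_commute)
      moreover have "convex S"
        using simp[OF S(1)] convex_simplex by blast
      ultimately have "aff_dim ?S < aff_dim S"
        using S by (intro face_of_aff_dim_lt) auto
      moreover have "aff_dim ?S = 1"
        using one_simplex_segment[OF ab(1)] aff_dim_simplex by blast
      ultimately show False
        using dim[OF S(1)] by simp
    qed
    \<comment> \<open>The end points are simplices themselves, so deleting all simplices other than
      the segment leaves exactly its interior.\<close>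
    moreover have "{a} \<in> \<C>" "{b} \<in> \<C>" "{a} \<noteq> ?S" "{b} \<noteq> ?S"
      using ends[OF ab(2)] ab by (auto simp: V_def)
    ultimately have "open_segment a b = \<Union>\<C> - \<Union>(\<C> - {?S})"
      using ab(2) unfolding open_segment_def by blast
    moreover have "closed (\<Union>(\<C> - {?S}))"
      using fin simp closed_simplex by (intro closed_Union) auto
    ultimately show ?thesis
      by (metis Diff_eq open_Compl openin_open_Int)
  qed
  show ?thesis
  proof (rule finite_graph_path_connected[OF finV finE Z _ _ _ _ K])
    fix e
    assume "e \<in> E"
    then obtain a b where ab: "a \<in> V" "b \<in> V" "a \<noteq> b" "closed_segment a b \<in> \<C>" "e = linepath a b"
      by (auto simp: E_def)
    then show "arc e" "pathstart e \<in> V"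
      by auto
    show "reversepath e \<in> E"
      using ab by (auto simp: E_def closed_segment_commute)
    have "e ` {0<..<1} = open_segment a b"
      using ab by (auto simp: open_segment_image_interval linepath_def)
    then show "openin (top_of_set (\<Union>\<C>)) (e ` {0<..<1})"
      using op ab by simp
  qed
qed

section \<open>Ordered arcs and the equivalence\<close>

lemma ordered_arc_continuous:
  assumes "ordered_arc X x y J r" "x \<noteq> y"
  obtains e where "continuous_map (top_of_set {0..1::real}) X e" "e 0 = x" "e 1 = y"
    "\<And>s. s \<in> {0..1} \<Longrightarrow> e s \<in> J" "\<And>s t. 0 \<le> s \<Longrightarrow> s \<le> t \<Longrightarrow> t \<le> 1 \<Longrightarrow> (e s, e t) \<in> r"
proof -
  obtain e where e: "embedding_map (top_of_set {0..1::real}) X e" "e 0 = x" "e 1 = y"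
    "J = e ` {0..1}" "r = {(e s, e t) | s t. 0 \<le> s \<and> s \<le> t \<and> t \<le> 1}"
    using assms unfolding ordered_arc_def by blast
  have "continuous_map (top_of_set {0..1::real}) X e"
    using homeomorphic_imp_continuous_map[OF e(1)[unfolded embedding_map_def]]
    by (simp add: continuous_map_in_subtopology)
  then show thesis
    by (rule that) (use e in auto)
qed

lemma embedding_map_arc:
  fixes k :: "real \<Rightarrow> 'a::t2_space"
  assumes "arc k" "path_image k \<subseteq> Z"
  shows "embedding_map (top_of_set {0..1}) (top_of_set Z) k"
proof -
  obtain h where h: "homeomorphism {0..1} (path_image k) k h"
    using homeomorphism_arc[OF \<open>arc k\<close>] by blast
  have "homeomorphic_maps (top_of_set {0..1}) (top_of_set (path_image k)) k h"
    using h by (auto simp: homeomorphic_maps_def homeomorphism_def)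
  then have "homeomorphic_map (top_of_set {0..1}) (top_of_set (path_image k)) k"
    by (rule homeomorphic_maps_imp_map)
  then show ?thesis
    using assms(2) by (simp add: embedding_map_def subtopology_subtopology Int_absorb1 path_image_def)
qed

theorem theorem2p10:
  fixes X :: "'a topology" and Y :: "'b::metric_space set" and f :: "'a \<Rightarrow> 'b" and \<epsilon> :: real
  assumes "compact_graph X"
    and "compact Y"
    and "continuous_map X (top_of_set Y) f"
    and "\<epsilon> > 0"
  shows "(eps_crooked X Y \<epsilon> f \<longleftrightarrow>
          (\<forall>e. continuous_map (top_of_set {0..1::real}) X e \<longrightarrow>
                eps_crooked (top_of_set {0..1::real}) Y \<epsilon> (f \<circ> e))) \<and>
         (eps_crooked X Y \<epsilon> f \<longleftrightarrow>
          (\<forall>x y J r. ordered_arc X x y J r \<longrightarrow>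
            (\<exists>x'\<in>J. \<exists>y'\<in>J. (x, y') \<in> r \<and> (y', x') \<in> r \<and> (x', y) \<in> r \<and>
               dist (f x) (f x') < \<epsilon> \<and> dist (f y) (f y') < \<epsilon>)))"
proof -
  let ?I = "top_of_set {0..1::real}"
  let ?ii = "\<forall>e. continuous_map ?I X e \<longrightarrow> eps_crooked ?I Y \<epsilon> (f \<circ> e)"
  let ?iii = "\<forall>x y J r. ordered_arc X x y J r \<longrightarrow>
    (\<exists>x'\<in>J. \<exists>y'\<in>J. (x, y') \<in> r \<and> (y', x') \<in> r \<and> (x', y) \<in> r \<and>
      dist (f x) (f x') < \<epsilon> \<and> dist (f y) (f y') < \<epsilon>)"
  have i_ii: ?ii if "eps_crooked X Y \<epsilon> f"
    using eps_crooked_compose[OF that] by blast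
  have ii_iii: ?iii if ii: ?ii
  proof (intro allI impI)
    fix x y J r
    assume J: "ordered_arc X x y J r"
    show "\<exists>x'\<in>J. \<exists>y'\<in>J. (x, y') \<in> r \<and> (y', x') \<in> r \<and> (x', y) \<in> r \<and>
      dist (f x) (f x') < \<epsilon> \<and> dist (f y) (f y') < \<epsilon>"
    proof (cases "x = y")
      case True
      then have "J = {x}" "r = {(x, x)}"
        using J by (auto simp: ordered_arc_def)
      then show ?thesis
        using True \<open>\<epsilon> > 0\<close> by simp
    next
      case False
      then obtain e where e: "continuous_map ?I X e" "e 0 = x" "e 1 = y"
        and eJ: "\<And>s. s \<in> {0..1} \<Longrightarrow> e s \<in> J"
        and er: "\<And>s t. 0 \<le> s \<Longrightarrow> s \<le> t \<Longrightarrow> t \<le> 1 \<Longrightarrow> (e s, e t) \<in> r"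
        using ordered_arc_continuous[OF J] by metis
      have "continuous_map ?I (top_of_set Y) (f \<circ> e)"
        using e(1) assms(3) by (rule continuous_map_compose)
      then have "(f \<circ> e) ` topspace ?I \<subseteq> topspace (top_of_set Y)"
        by (rule continuous_map_image_subset_topspace)
      then have "(f \<circ> e) 0 \<in> Y" "(f \<circ> e) 1 \<in> Y"
        by (auto simp: image_subset_iff)
      moreover have "eps_crooked ?I Y \<epsilon> (f \<circ> e)"
        using ii e(1) by blast
      ultimately obtain s t where st: "0 \<le> s" "s \<le> t" "t \<le> 1"
        "dist ((f \<circ> e) 0) ((f \<circ> e) t) < \<epsilon>" "dist ((f \<circ> e) 1) ((f \<circ> e) s) < \<epsilon>"
        using eps_crooked_interval by metis
      \<comment> \<open>The later time \<open>t\<close> gives \<open>x'\<close> and the earlier time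
        \<open>s\<close> gives \<open>y'\<close>.\<close>
      then show ?thesis
        using e(2,3) eJ[of s] eJ[of t] er[of 0 s] er[of s t] er[of t 1]
        by (rule_tac bexI[of _ "e t"], rule_tac bexI[of _ "e s"]) auto
    qed
  qed
  have iii_i: "eps_crooked X Y \<epsilon> f" if iii: ?iii
  proof -
    obtain \<C> :: "(real^3) set set" where \<C>: "simplicial_complex \<C>" "\<And>S. S \<in> \<C> \<Longrightarrow> aff_dim S \<le> 1"
      and "X homeomorphic_space top_of_set (\<Union>\<C>)"
      using assms(1) unfolding compact_graph_def by blast
    then obtain g h where gh: "homeomorphic_maps X (top_of_set (\<Union>\<C>)) g h"
      unfolding homeomorphic_space_def by blast
    then have g: "continuous_map X (top_of_set (\<Union>\<C>)) g" and h: "continuous_map (top_of_set (\<Union>\<C>)) X h"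
      and hg: "\<And>x. x \<in> topspace X \<Longrightarrow> h (g x) = x"
      by (auto simp: homeomorphic_maps_def)
    have "homeomorphic_map (top_of_set (\<Union>\<C>)) X h"
      using gh homeomorphic_maps_map by blast
    then have emb: "embedding_map (top_of_set (\<Union>\<C>)) X h"
      using surjective_embedding_map by blast
    \<comment> \<open>The argument takes place on the polyhedron; arcs there are carried by
      \<open>h\<close> to ordered arcs of \<open>X\<close>, where \<open>iii\<close>
      applies.\<close>
    have "eps_crooked (top_of_set (\<Union>\<C>)) Y \<epsilon> (f \<circ> h)"
    proof (rule eps_crooked_if_arcs)
      show "compact (\<Union>\<C>)"
        using \<C>(1) unfolding simplicial_complex_def
        by (intro compact_Union) (auto intro: compact_simplex)
      show "path_connected C" if "C \<subseteq> \<Union>\<C>" "compact C" "connected C" for C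
        using simplicial_complex_dim_1_path_connected[OF \<C>] that compact_imp_closed by blast
      show "continuous_map (top_of_set (\<Union>\<C>)) (top_of_set Y) (f \<circ> h)"
        using h assms(3) by (rule continuous_map_compose)
      show "\<epsilon> > 0"
        by (rule assms(4))
      fix k :: "real \<Rightarrow> real^3"
      assume k: "arc k" "path_image k \<subseteq> \<Union>\<C>"
      let ?e = "h \<circ> k"
      have e: "embedding_map ?I X ?e"
        using embedding_map_arc[OF k] emb by (rule embedding_map_compose)
      have "inj_on ?e {0..1}"
        using homeomorphic_imp_injective_map[OF e[unfolded embedding_map_def]] by simp
      show "\<exists>s t. 0 \<le> s \<and> s \<le> t \<and> t \<le> 1 \<and> dist ((f \<circ> h) (k 0)) ((f \<circ> h) (k t)) < \<epsilon> \<and>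
          dist ((f \<circ> h) (k 1)) ((f \<circ> h) (k s)) < \<epsilon>"
      proof -
        have "?e 0 \<noteq> ?e 1"
          using inj_onD[OF \<open>inj_on ?e {0..1}\<close>, of 0 1] by auto
        then have "ordered_arc X (?e 0) (?e 1) (?e ` {0..1}) {(?e s, ?e t) | s t. 0 \<le> s \<and> s \<le> t \<and> t \<le> 1}"
          using e unfolding ordered_arc_def by blast
        then obtain x' y' where "(y', x') \<in> {(?e s, ?e t) | s t. 0 \<le> s \<and> s \<le> t \<and> t \<le> 1}"
          "dist (f (?e 0)) (f x') < \<epsilon>" "dist (f (?e 1)) (f y') < \<epsilon>"
          using iii by meson
        then show ?thesis
          by auto
      qed
    qed
    \<comment> \<open>Composition with \<open>g\<close> returns to \<open>X\<close>, where the
      composite agrees with \<open>f\<close> on \<open>topspace X\<close>.\<close>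
    then have "eps_crooked X Y \<epsilon> ((f \<circ> h) \<circ> g)"
      using g by (rule eps_crooked_compose)
    then show ?thesis
      using eps_crooked_cong[of X "(f \<circ> h) \<circ> g" f] hg by simp
  qed
  show ?thesis
    using i_ii ii_iii iii_i by blast
qed

end
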